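(* Let $S$ be a $*$-monoid and let $a,v\in S$. Then $a$ is dual $v$-core invertible if and only if $v$ is invertible along $a$ and $a$ has a $\{1,4\}$-inverse. In this case, writing $a_{v,\#}$ for the dual $v$-core inverse of $a$, one has $a_{v,\#}=a^{(1,4)}v^{\parallel a}=a^{(1,4)}a(va)^\#=a^{(1,4)}(av)^\#a$.
   Context: A $*$-monoid is a semigroup $S$ with identity $1$ and a map $*$ satisfying $(x^* )^*=x$ and $(xy)^*=y^*x^*$ for all $x,y\in S$. For $a,v\in S$, $a$ is dual $v$-core invertible if there exists $y\in S$ with $avay=a$, $y^2va=y$ and $(yva)^*=yva$. Such a $y$ is called a dual $v$-core inverse of $a$; it is unique if it exists and is denoted here by $a_{v,\#}$. For $a,d\in S$, $a$ is invertible along $d$ if there exists $b\in S$ with $bad=d=dab$ and $b\in dS\cap Sd$. Such a $b$ is unique if it exists and is denoted $a^{\parallel d}$. A $\{1,4\}$-inverse of $a$ is an $x\in S$ with $axa=a$ and $(xa)^*=xa$; $a^{(1,4)}$ denotes an arbitrary $\{1,4\}$-inverse of $a$. The group inverse $c^\#$ of $c\in S$ is the (unique, if it exists) $x\in S$ with $cx=xc$, $xcx=x$, $c=c^2x$. *)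

theory Defs
  imports Main
begin

class star_monoid = monoid_mult +
  fixes star :: "'a \<Rightarrow> 'a"
  assumes star_star [simp]: "star (star x) = x"
    and star_mult: "star (x * y) = star y * star x"

definition is_dual_core_inverse :: "'a::star_monoid \<Rightarrow> 'a \<Rightarrow> 'a \<Rightarrow> bool" where
  "is_dual_core_inverse v a y \<longleftrightarrow>
     a * v * a * y = a \<and> y ^ 2 * v * a = y \<and> star (y * v * a) = y * v * a"

definition dual_core_invertible :: "'a::star_monoid \<Rightarrow> 'a \<Rightarrow> bool" where
  "dual_core_invertible v a \<longleftrightarrow> (\<exists>y. is_dual_core_inverse v a y)"

definition dual_core_inverse :: "'a::star_monoid \<Rightarrow> 'a \<Rightarrow> 'a" where
  "dual_core_inverse v a = (THE y. is_dual_core_inverse v a y)"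

definition is_inverse_along :: "'a::monoid_mult \<Rightarrow> 'a \<Rightarrow> 'a \<Rightarrow> bool" where
  "is_inverse_along a d b \<longleftrightarrow>
     b * a * d = d \<and> d = d * a * b \<and> b \<in> range (\<lambda>s. d * s) \<inter> range (\<lambda>s. s * d)"

definition invertible_along :: "'a::monoid_mult \<Rightarrow> 'a \<Rightarrow> bool" where
  "invertible_along a d \<longleftrightarrow> (\<exists>b. is_inverse_along a d b)"

definition inverse_along :: "'a::monoid_mult \<Rightarrow> 'a \<Rightarrow> 'a" where
  "inverse_along a d = (THE b. is_inverse_along a d b)"

definition is_14_inverse :: "'a::star_monoid \<Rightarrow> 'a \<Rightarrow> bool" where
  "is_14_inverse a x \<longleftrightarrow> a * x * a = a \<and> star (x * a) = x * a"

definition is_group_inverse :: "'a::monoid_mult \<Rightarrow> 'a \<Rightarrow> bool" where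
  "is_group_inverse c x \<longleftrightarrow> c * x = x * c \<and> x * c * x = x \<and> c = c ^ 2 * x"

definition group_invertible :: "'a::monoid_mult \<Rightarrow> bool" where
  "group_invertible c \<longleftrightarrow> (\<exists>x. is_group_inverse c x)"

definition group_inverse :: "'a::monoid_mult \<Rightarrow> 'a" where
  "group_inverse c = (THE x. is_group_inverse c x)"

text \<open>
  The following uniqueness lemmas justify the definite descriptions above.
\<close>

lemma is_inverse_along_unique:
  assumes "is_inverse_along a d b" and "is_inverse_along a d c"
  shows "b = c"
proof -
  from assms obtain s t where b: "b = s * d" and c: "c = d * t"
    unfolding is_inverse_along_def by blast
  have d: "d * a * c = d" "b * a * d = d"
    using assms unfolding is_inverse_along_def by auto
  have "b = s * (d * a * c)" using b d(1) by simp
  also have "\<dots> = b * a * c" using b by (simp add: mult.assoc)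
  also have "\<dots> = b * a * d * t" using c by (simp add: mult.assoc)
  also have "\<dots> = c" using c d(2) by simp
  finally show ?thesis .
qed

lemma is_group_inverse_unique:
  assumes "is_group_inverse c x" and "is_group_inverse c y"
  shows "x = y"
proof -
  have x: "c * x = x * c" "x * c * x = x" "c * x * c = c"
    and y: "c * y = y * c" "y * c * y = y" "c * y * c = c"
    using assms unfolding is_group_inverse_def
    by (metis mult.assoc power2_eq_square)+
  have "x * c = c * y"
    using x y by (metis mult.assoc)
  then show ?thesis
    using x y by (metis mult.assoc)
qed

lemma is_dual_core_inverse_unique:
  assumes "is_dual_core_inverse v a y" and "is_dual_core_inverse v a z"
  shows "y = z"
proof -
  have y: "a * v * a * y = a" "y * y * v * a = y" "star (y * v * a) = y * v * a"
    and z: "a * v * a * z = a" "z * z * v * a = z" "star (z * v * a) = z * v * a"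
    using assms unfolding is_dual_core_inverse_def by (auto simp: power2_eq_square)
  have az: "a * w * v * a = a" if "a * v * a * w = a" "w * w * v * a = w" for w
    using that by (metis mult.assoc)
  have pq: "y * v * a * (z * v * a) = y * v * a" "z * v * a * (y * v * a) = z * v * a"
    using az[OF y(1,2)] az[OF z(1,2)] by (simp_all add: mult.assoc)
  have eq: "y * v * a = z * v * a"
    using pq y(3) z(3) by (metis star_mult)
  have "y = y * y * v * (a * v * a * z)" using y(2) z(1) by simp
  also have "\<dots> = y * y * v * a * v * a * z" by (simp add: mult.assoc)
  also have "\<dots> = y * v * a * z" using y(2) by simp
  also have "\<dots> = z * v * a * z" using eq by simp
  also have "\<dots> = z * z * v * a * v * a * z" using z(2) by simp
  also have "\<dots> = z * z * v * (a * v * a * z)" by (simp add: mult.assoc)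
  also have "\<dots> = z" using z(1,2) by simp
  finally show ?thesis .
qed

lemma dual_core_inverse_eqI:
  "is_dual_core_inverse v a y \<Longrightarrow> dual_core_inverse v a = y"
  unfolding dual_core_inverse_def using is_dual_core_inverse_unique by blast

lemma inverse_along_eqI: "is_inverse_along a d b \<Longrightarrow> inverse_along a d = b"
  unfolding inverse_along_def using is_inverse_along_unique by blast

lemma group_inverse_eqI: "is_group_inverse c x \<Longrightarrow> group_inverse c = x"
  unfolding group_inverse_def using is_group_inverse_unique by blast

end

(* If b is the inverse of v along a and b = a s = t a, then t b = t a s = b s, and this common
   value m yields the group inverses m v of a v and v m of v a; moreover a (v m) = b = (m v) a.
   A dual v-core inverse y of a gives the inverse a y of v along a and the {1,4}-inverse y v of a;
   conversely x b is a dual v-core inverse of a for every {1,4}-inverse x of a. *)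
theory Submission
  imports Defs
begin

lemma is_inverse_along_group_inverse:
  assumes "is_inverse_along v a b"
  obtains m where "is_group_inverse (v * a) (v * m)" "a * (v * m) = b"
    "is_group_inverse (a * v) (m * v)" "(m * v) * a = b"
proof -
  from assms obtain s t where s: "b = a * s" and t: "b = t * a"
    and bva: "b * v * a = a" and avb: "a * v * b = a"
    unfolding is_inverse_along_def by fastforce
  define m where "m = t * b"
  \<comment> \<open>Both forms of \<open>m\<close> are needed: \<open>t * b\<close> lets
    \<open>b * v * a = a\<close> collapse \<open>m * (v * a)\<close> to \<open>t * a = b\<close>,
    and \<open>b * s\<close> lets \<open>a * v * b = a\<close> collapse \<open>a * (v * m)\<close>
    to \<open>a * s = b\<close>.\<close>
  have m: "m = b * s"
    unfolding m_def using s t by (metis mult.assoc)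
  have mva: "m * (v * a) = b"
    using bva t by (simp add: m_def mult.assoc)
  have avm: "a * (v * m) = b"
    using avb s by (simp add: m mult.assoc[symmetric])
  have bvb: "b * (v * b) = b"
    using bva s by (metis mult.assoc)
  have bvm: "b * (v * m) = m"
    using bvb by (simp add: m mult.assoc[symmetric])
  \<comment> \<open>The trailing \<open>z\<close> lets these identities rewrite inside
    right-associated products; the versions without \<open>z\<close> handle the end of a
    word.\<close>
  have rules: "m * (v * (a * z)) = b * z" "a * (v * (m * z)) = b * z"
    "b * (v * (m * z)) = m * z" "a * (v * (b * z)) = a * z" for z
    using mva avm bvm avb by (metis mult.assoc)+
  have avb': "a * (v * b) = a"
    using avb by (simp add: mult.assoc)
  \<comment> \<open>Both products of \<open>v * a\<close> and \<open>v * m\<close> reduce to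
    \<open>v * b\<close>; in the mirrored case below, both products reduce to
    \<open>b * v\<close>.\<close>
  have "is_group_inverse (v * a) (v * m)"
    by (simp add: is_group_inverse_def power2_eq_square mult.assoc rules mva avm bvm avb')
  moreover have "is_group_inverse (a * v) (m * v)"
    by (simp add: is_group_inverse_def power2_eq_square mult.assoc rules mva avm bvm avb')
  ultimately show thesis
    using that mva avm by (simp add: mult.assoc)
qed

text \<open>As \<open>b\<close> lies in both \<open>a S\<close> and \<open>S a\<close>, it is fixed
  by \<open>a * x\<close> on the left and by \<open>x * a\<close> on the right. Moreover
  \<open>b * v * a = a\<close> turns \<open>(x * b) * v * a\<close> into the self-adjoint element
  \<open>x * a\<close>.\<close>

lemma is_dual_core_inverse_if_inverse_along:
  assumes "is_inverse_along v a b" and "is_14_inverse a x"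
  shows "is_dual_core_inverse v a (x * b)"
proof -
  from assms(1) obtain s t where s: "b = a * s" and t: "b = t * a"
    and bva: "b * v * a = a" and avb: "a * v * b = a"
    unfolding is_inverse_along_def by fastforce
  have axa: "a * x * a = a" and star: "star (x * a) = x * a"
    using assms(2) unfolding is_14_inverse_def by auto
  have axb: "a * x * b = b"
    using axa s by (metis mult.assoc)
  have bxa: "b * x * a = b"
    using axa t by (metis mult.assoc)
  have yva: "x * b * v * a = x * a"
    using bva by (simp add: mult.assoc)
  have "a * v * a * (x * b) = a"
    using axb avb by (simp add: mult.assoc)
  moreover have "(x * b) ^ 2 * v * a = x * b"
    using yva bxa by (simp add: power2_eq_square mult.assoc)
  ultimately show ?thesis
    using yva star by (simp add: is_dual_core_inverse_def)
qed

text \<open>Replacing the leading \<open>a\<close> by \<open>a * v * a * y\<close> creates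
  \<open>y * y * v * a = y\<close>, which leaves \<open>a * v * a * y = a\<close>. This gives both
  the left identity for the inverse \<open>a * y\<close> along \<open>a\<close> and the inner
  inverse property of \<open>y * v\<close>.\<close>

lemma is_dual_core_inverse_outer:
  assumes "is_dual_core_inverse v a y"
  shows "a * y * v * a = a"
  using assms unfolding is_dual_core_inverse_def power2_eq_square
  by (metis mult.assoc)

lemma is_inverse_along_if_dual_core_inverse:
  assumes "is_dual_core_inverse v a y"
  shows "is_inverse_along v a (a * y)"
proof -
  have y: "a * v * a * y = a" "y * y * v * a = y"
    using assms by (simp_all add: is_dual_core_inverse_def power2_eq_square)
  \<comment> \<open>Membership in \<open>a S\<close> is evident; membership in \<open>S a\<close>
    comes from \<open>y = y * y * v * a\<close>.\<close>
  have "a * y = (a * y * y * v) * a"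
    using y(2) by (simp add: mult.assoc)
  then have "a * y \<in> range (\<lambda>s. s * a)"
    by (rule range_eqI)
  then show ?thesis
    using y(1) is_dual_core_inverse_outer[OF assms]
    by (simp add: is_inverse_along_def mult.assoc)
qed

lemma is_14_inverse_if_dual_core_inverse:
  assumes "is_dual_core_inverse v a y"
  shows "is_14_inverse a (y * v)"
  using assms is_dual_core_inverse_outer[OF assms]
  by (simp add: is_14_inverse_def is_dual_core_inverse_def mult.assoc)

theorem theorem2p18:
  fixes a v :: "'a::star_monoid"
  shows "(dual_core_invertible v a \<longleftrightarrow>
            invertible_along v a \<and> (\<exists>x. is_14_inverse a x)) \<and>
         (dual_core_invertible v a \<longrightarrow>
            group_invertible (v * a) \<and> group_invertible (a * v) \<and>
            (\<forall>x. is_14_inverse a x \<longrightarrow>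
               dual_core_inverse v a = x * inverse_along v a \<and>
               dual_core_inverse v a = x * a * group_inverse (v * a) \<and>
               dual_core_inverse v a = x * group_inverse (a * v) * a))"
proof (intro conjI impI)
  show iff: "dual_core_invertible v a \<longleftrightarrow>
      invertible_along v a \<and> (\<exists>x. is_14_inverse a x)"
    unfolding dual_core_invertible_def invertible_along_def
    using is_dual_core_inverse_if_inverse_along is_inverse_along_if_dual_core_inverse
      is_14_inverse_if_dual_core_inverse by blast
  assume "dual_core_invertible v a"
  with iff obtain b where b: "is_inverse_along v a b"
    unfolding invertible_along_def by blast
  obtain m where m: "is_group_inverse (v * a) (v * m)" "a * (v * m) = b"
    "is_group_inverse (a * v) (m * v)" "(m * v) * a = b"
    using is_inverse_along_group_inverse[OF b] .
  show "group_invertible (v * a)" "group_invertible (a * v)"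
    using m(1,3) unfolding group_invertible_def by blast+
  show "\<forall>x. is_14_inverse a x \<longrightarrow>
      dual_core_inverse v a = x * inverse_along v a \<and>
      dual_core_inverse v a = x * a * group_inverse (v * a) \<and>
      dual_core_inverse v a = x * group_inverse (a * v) * a"
  proof (intro allI impI)
    fix x
    assume "is_14_inverse a x"
    \<comment> \<open>Uniqueness of the dual core inverse makes \<open>x * b\<close> independent of
      the choice of \<open>x\<close>.\<close>
    then have "dual_core_inverse v a = x * b"
      using is_dual_core_inverse_if_inverse_along[OF b] by (blast intro: dual_core_inverse_eqI)
    \<comment> \<open>The three formulas are \<open>x * b\<close> with \<open>b\<close> read as the
      inverse along \<open>a\<close>, as \<open>a * (v * m)\<close> and as
      \<open>(m * v) * a\<close>.\<close>
    then show "dual_core_inverse v a = x * inverse_along v a \<and>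
        dual_core_inverse v a = x * a * group_inverse (v * a) \<and>
        dual_core_inverse v a = x * group_inverse (a * v) * a"
      using inverse_along_eqI[OF b] group_inverse_eqI[OF m(1)] group_inverse_eqI[OF m(3)] m(2,4)
      by (simp add: mult.assoc)
  qed
qed

end
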